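(* Let $\xi \in \mathbb{R}\setminus\mathbb{Q}$ and let $n$ be a positive integer. There exist positive constants $c_1, c_2$, depending only on $\xi$ and $n$, with the following properties. (i) There are infinitely many algebraic numbers $\alpha$ of degree $n$ such that \[ \max_{\bar\alpha} |\xi - \bar\alpha| \le c_1 H(\alpha)^{-2/n}, \] where the maximum is taken over all conjugates $\bar\alpha$ of $\alpha$ (including $\alpha$ itself). (ii) There are infinitely many algebraic integers $\alpha$ of degree $n+1$ such that \[ \max_{\bar\alpha \neq \alpha} |\xi - \bar\alpha| \le c_2 H(\alpha)^{-2/n}, \] where the maximum is taken over all conjugates $\bar\alpha$ of $\alpha$ different from $\alpha$.
   Context: The height $H(P)$ of a polynomial $P \in \mathbb{R}[T]$ is the largest absolute value of its coefficients. The height $H(\alpha)$ of an algebraic number $\alpha \in \mathbb{C}$ is the height of its irreducible (minimal) polynomial in $\mathbb{Z}[T]$ (primitive, with integer coefficients). Conjugates of $\alpha$ are the roots of its minimal polynomial over $\mathbb{Q}$. *)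

theory Defs
  imports "HOL-Computational_Algebra.Computational_Algebra" "HOL-Analysis.Analysis"
begin

definition height_poly :: "int poly \<Rightarrow> int" where
  "height_poly p = Max (insert 0 ((\<lambda>c. \<bar>c\<bar>) ` set (coeffs p)))"

text \<open>p is the (primitive, irreducible) minimal polynomial of alpha in Z[T],
  normalised to positive leading coefficient. Irreducibility in Z[T] forces primitivity.\<close>
definition is_min_int_poly :: "complex \<Rightarrow> int poly \<Rightarrow> bool" where
  "is_min_int_poly \<alpha> p \<longleftrightarrow> irreducible p \<and> lead_coeff p > 0 \<and>
     poly (map_poly of_int p) \<alpha> = 0"

definition min_int_poly :: "complex \<Rightarrow> int poly" where
  "min_int_poly \<alpha> = (THE p. is_min_int_poly \<alpha> p)"

definition alg_height :: "complex \<Rightarrow> int" where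
  "alg_height \<alpha> = height_poly (min_int_poly \<alpha>)"

definition alg_degree :: "complex \<Rightarrow> nat" where
  "alg_degree \<alpha> = degree (min_int_poly \<alpha>)"

definition conjugates :: "complex \<Rightarrow> complex set" where
  "conjugates \<alpha> = {z. poly (map_poly of_int (min_int_poly \<alpha>)) z = 0}"

end

theory Submission
  imports Defs "HOL-Analysis.Kronecker_Approximation_Theorem"
begin

text \<open>
  Choose \<open>h / k\<close> with \<open>\<bar>k \<xi> - h\<bar> \<le> 1 / k\<close> and complete \<open>(h, k)\<close> to a unimodular matrix with
  second row \<open>(p, q)\<close>. The products \<open>L\<^sup>i M\<^sup>n\<^sup>-\<^sup>i\<close> of \<open>L = q T - p\<close> and \<open>M = k T - h\<close> form a basis of the
  polynomials of degree at most \<open>n\<close>, over the integers as well as over the reals. So one may prescribe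
  an integer polynomial modulo 4, which makes it an Eisenstein polynomial for the prime 2, and at
  the same time place its real coordinates, shifted by those of a given real polynomial, in \<open>[1, 5]\<close>.
  For (i) the shift is 0. For (ii) it is \<open>T\<^sup>n\<^sup>+\<^sup>1 - (T - \<xi>)\<^sup>n\<^sup>+\<^sup>1\<close>, so that adding \<open>T\<^sup>n\<^sup>+\<^sup>1\<close> gives
  \<open>(T - \<xi>)\<^sup>n\<^sup>+\<^sup>1\<close> plus a form with coordinates in \<open>[1, 5]\<close>. The height is \<open>O(k\<^sup>n)\<close>, and all roots, in
  case (ii) all but at most one, are at distance \<open>O(k\<^sup>-\<^sup>2)\<close> from \<open>\<xi>\<close>.
\<close>

section \<open>Integer polynomials and minimal polynomials\<close>

text \<open>Let \<open>i\<close> be the first index at which \<open>A\<close> has an odd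
  coefficient. Modulo 2, only the product of \<open>coeff A i\<close> and \<open>coeff B 0\<close>
  survives in coefficient \<open>i\<close> of \<open>A * B\<close>, so this coefficient is odd.
  Hence \<open>i\<close> is at least the degree of \<open>A * B\<close>, while \<open>i\<close> is
  at most the degree of \<open>A\<close>.\<close>

lemma eisenstein_two_factor:
  fixes A B :: "int poly"
  assumes odd: "odd (lead_coeff (A * B))"
    and even: "\<And>i. i < degree (A * B) \<Longrightarrow> even (coeff (A * B) i)"
    and B0: "odd (coeff B 0)"
  shows "degree B = 0"
proof -
  have nz: "A \<noteq> 0" "B \<noteq> 0" using odd by auto
  define i where "i = (LEAST i. odd (coeff A i))"
  have "\<exists>i. odd (coeff A i)"
  proof (rule ccontr)
    assume "\<nexists>i. odd (coeff A i)"
    hence "even (coeff (A * B) m)" for m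
      by (auto simp: coeff_mult intro!: dvd_sum)
    thus False using odd by blast
  qed
  hence i: "odd (coeff A i)" and less: "\<And>j. j < i \<Longrightarrow> even (coeff A j)"
    unfolding i_def by (rule LeastI_ex) (auto dest: not_less_Least)
  have "coeff (A * B) i = (\<Sum>j<i. coeff A j * coeff B (i - j)) + coeff A i * coeff B 0"
    by (simp add: coeff_mult flip: lessThan_Suc_atMost)
  moreover have "even (\<Sum>j<i. coeff A j * coeff B (i - j))"
    by (intro dvd_sum) (auto simp: less)
  ultimately have "odd (coeff (A * B) i)" using i B0 by simp
  hence "degree (A * B) \<le> i" using even by (meson not_less)
  moreover have "i \<le> degree A" using i by (intro le_degree) auto
  ultimately show ?thesis using nz by (simp add: degree_mult_eq)
qed

text \<open>Since 4 does not divide the constant coefficient, one of two factors has an odd constant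
  coefficient and is therefore constant. Irreducibility is meant over the integers, so content 1 is
  what makes this constant a unit.\<close>

lemma eisenstein_two:
  fixes P :: "int poly"
  assumes deg: "degree P > 0" and odd: "odd (lead_coeff P)"
    and even: "\<And>i. i < degree P \<Longrightarrow> even (coeff P i)"
    and four: "\<not> 4 dvd coeff P 0" and content: "Polynomial.content P = 1"
  shows "irreducible P"
proof (rule irreducibleI)
  show "P \<noteq> 0" using deg by auto
  show "\<not> P dvd 1" using deg by (auto simp: is_unit_poly_iff)
  have *: "b dvd 1" if P: "P = a * b" and b: "odd (coeff b 0)" for a b
  proof -
    have "degree b = 0"
      using eisenstein_two_factor[of a b] odd even b unfolding P by blast
    then obtain c where c: "b = [:c:]" by (rule degree_eq_zeroE)
    hence "[:c:] dvd P" unfolding P by (metis dvd_triv_right)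
    hence "c dvd 1" unfolding const_poly_dvd_iff_dvd_content content .
    thus ?thesis using c by (simp add: is_unit_const_poly_iff)
  qed
  fix a b assume P: "P = a * b"
  have "odd (coeff a 0) \<or> odd (coeff b 0)"
  proof (rule ccontr)
    assume "\<not> ?thesis"
    hence "2 * 2 dvd coeff a 0 * coeff b 0" by (intro mult_dvd_mono) auto
    thus False using four P by (simp add: coeff_mult)
  qed
  thus "a dvd 1 \<or> b dvd 1" using *[of a b] *[of b a] P by (auto simp: mult.commute)
qed

text \<open>Stated for an arbitrary ring homomorphism so that it serves for \<open>of_int\<close>
  into the reals and the complex numbers as well as for \<open>of_real\<close>.\<close>

lemma map_poly_hom:
  fixes f :: "'a :: comm_ring_1 \<Rightarrow> 'b :: comm_ring_1"
  assumes add: "\<And>x y. f (x + y) = f x + f y"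
    and mult: "\<And>x y. f (x * y) = f x * f y" and one: "f 1 = 1"
  shows "map_poly f (p + q) = map_poly f p + map_poly f q"
    and "map_poly f (smult c p) = smult (f c) (map_poly f p)"
    and "map_poly f (p * q) = map_poly f p * map_poly f q"
    and "map_poly f (p ^ n) = map_poly f p ^ n"
    and "map_poly f (\<Sum>i\<in>I. g i) = (\<Sum>i\<in>I. map_poly f (g i))"
proof -
  have zero: "f 0 = 0" using add[of 0 0] by simp
  show A: "map_poly f (p + q) = map_poly f p + map_poly f q" for p q
    by (rule poly_eqI) (simp add: coeff_map_poly zero add)
  show S: "map_poly f (smult c p) = smult (f c) (map_poly f p)" for c p
    by (rule poly_eqI) (simp add: coeff_map_poly zero mult)
  show M: "map_poly f (p * q) = map_poly f p * map_poly f q" for p q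
    by (induction p) (simp_all add: mult_pCons_left map_poly_pCons A S zero)
  show "map_poly f (p ^ n) = map_poly f p ^ n"
    by (induction n) (simp_all add: M one)
  show "map_poly f (\<Sum>i\<in>I. g i) = (\<Sum>i\<in>I. map_poly f (g i))"
    by (induction I rule: infinite_finite_induct) (simp_all add: A)
qed

lemmas map_poly_of_int_hom =
  map_poly_hom[of of_int, OF of_int_add of_int_mult of_int_1]
lemmas map_poly_of_real_hom =
  map_poly_hom[of of_real, OF of_real_add of_real_mult of_real_1]

section \<open>Uniqueness of the minimal polynomial over the integers\<close>

text \<open>Pseudo-division keeps everything over the integers: by minimality of the degree of
  \<open>f\<close> the remainder vanishes, so \<open>smult a p = f * s\<close>. The prime element
  \<open>p\<close> divides \<open>f\<close> or \<open>s\<close>. In the second case \<open>f\<close>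
  would divide the nonzero constant \<open>a\<close>, although a nonzero constant has no root. So
  \<open>p\<close> divides \<open>f\<close>, and minimality makes the cofactor constant.\<close>

lemma irreducible_dvd_minimal:
  fixes f p :: "int poly" and \<alpha> :: complex
  assumes f: "f \<noteq> 0" "poly (map_poly of_int f) \<alpha> = 0"
    and min: "\<And>g. g \<noteq> 0 \<Longrightarrow> poly (map_poly of_int g) \<alpha> = 0 \<Longrightarrow> degree f \<le> degree g"
    and p: "irreducible p" "poly (map_poly of_int p) \<alpha> = 0"
  obtains c where "c \<noteq> 0" "f = smult c p"
proof -
  have p0: "p \<noteq> 0" using p by auto
  obtain a s where a: "a \<noteq> 0" and eq: "smult a p = f * s + pseudo_mod p f"
    using pseudo_mod(1)[OF f(1)] by blast
  have "poly (map_poly of_int (smult a p)) \<alpha> = poly (map_poly of_int (f * s + pseudo_mod p f)) \<alpha>"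
    using eq by simp
  hence "poly (map_poly of_int (pseudo_mod p f)) \<alpha> = 0"
    by (simp add: map_poly_of_int_hom f p)
  hence "pseudo_mod p f = 0" using pseudo_mod(2)[OF f(1)] min leD by blast
  hence eq: "smult a p = f * s" using eq by simp
  have deg0: "degree g > 0" if "g \<noteq> 0" "poly (map_poly of_int g) \<alpha> = 0" for g :: "int poly"
  proof (rule ccontr)
    assume "\<not> ?thesis"
    then obtain c where "g = [:c:]" by (auto elim: degree_eq_zeroE)
    thus False using that by (auto simp: map_poly_pCons)
  qed
  have "p dvd f * s" by (metis dvd_refl dvd_smult eq)
  moreover have "\<not> p dvd s"
  proof
    assume "p dvd s"
    then obtain t where t: "s = p * t" by (elim dvdE)
    have "p * [:a:] = p * (f * t)" using eq by (simp add: t algebra_simps)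
    hence "[:a:] = f * t" using p0 by (metis mult_left_cancel)
    hence "degree f = 0" using a by (metis degree_mult_eq degree_pCons_0 add_is_0 mult_eq_0_iff pCons_eq_0_iff)
    thus False using deg0[OF f] by simp
  qed
  ultimately have "p dvd f"
    using p(1) irreducible_imp_prime_elem_gcd prime_elem_dvd_mult_iff by blast
  then obtain t where t: "f = p * t" by (elim dvdE)
  have "t \<noteq> 0" using t f by auto
  hence "degree t = 0" using min[OF p0 p(2)] t p0 by (simp add: degree_mult_eq)
  then obtain c where "t = [:c:]" by (rule degree_eq_zeroE)
  thus ?thesis using that[of c] t \<open>t \<noteq> 0\<close> by (auto simp: mult.commute)
qed

text \<open>Two candidates are compared through a polynomial \<open>f\<close> of least degree
  vanishing at \<alpha>, which is a constant multiple of each. Both candidates are irreducible and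
  not constant, hence primitive, so comparing contents shows that the constants agree up to sign.
  The positive leading coefficients settle the sign.\<close>

lemma min_int_poly_eqI:
  assumes "irreducible p" "lead_coeff p > 0" "poly (map_poly of_int p) \<alpha> = 0"
  shows "min_int_poly \<alpha> = p"
  unfolding min_int_poly_def
proof (rule the_equality)
  show "is_min_int_poly \<alpha> p" using assms by (simp add: is_min_int_poly_def)
  fix r assume "is_min_int_poly \<alpha> r"
  hence r: "irreducible r" "lead_coeff r > 0" "poly (map_poly of_int r) \<alpha> = 0"
    by (auto simp: is_min_int_poly_def)
  define vanish where "vanish g \<longleftrightarrow> g \<noteq> 0 \<and> poly (map_poly of_int g) \<alpha> = 0" for g :: "int poly"
  have "vanish p" using assms by (auto simp: vanish_def)
  then obtain f where f: "vanish f" and min: "\<And>g. vanish g \<Longrightarrow> degree f \<le> degree g"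
    using ex_has_least_nat[of vanish p degree] by blast
  have obt: "\<exists>c. c \<noteq> 0 \<and> f = smult c s" if "irreducible s" "poly (map_poly of_int s) \<alpha> = 0" for s
    using irreducible_dvd_minimal[of f \<alpha> s] f min that unfolding vanish_def by metis
  obtain c d where c: "c \<noteq> 0" "f = smult c p" and d: "d \<noteq> 0" "f = smult d r"
    using obt[OF assms(1,3)] obt[OF r(1,3)] by blast
  have deg: "degree p > 0"
  proof (rule ccontr)
    assume "\<not> ?thesis"
    then obtain c where "p = [:c:]" by (auto elim: degree_eq_zeroE)
    thus False using assms by (auto simp: map_poly_pCons)
  qed
  have content: "Polynomial.content s = 1" if s: "irreducible s" "degree s > 0" for s :: "int poly"
  proof -
    have eq: "s = [:Polynomial.content s:] * primitive_part s" by simp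
    have "\<not> primitive_part s dvd 1"
      using s(2) by (metis degree_primitive_part is_unit_poly_iff degree_pCons_0 less_irrefl)
    hence "[:Polynomial.content s:] dvd 1" using irreducibleD[OF s(1) eq] by blast
    thus ?thesis by (metis is_unit_const_poly_iff is_unit_normalize normalize_content)
  qed
  have "degree r = degree p" using c d by (metis degree_smult_eq)
  hence "Polynomial.content p = 1" "Polynomial.content r = 1" using content assms r deg by auto
  moreover have "Polynomial.content (smult c p) = Polynomial.content (smult d r)" using c d by simp
  ultimately have "\<bar>c\<bar> = \<bar>d\<bar>" by simp
  moreover have "lead_coeff f = c * lead_coeff p" "lead_coeff f = d * lead_coeff r"
    using c(2) d(2) by (metis lead_coeff_smult)+
  hence "sgn c = sgn d" using assms(2) r(2) by (metis mult.right_neutral sgn_mult sgn_pos)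
  ultimately have "c = d" by (metis sgn_mult_abs)
  thus "r = p" using c d by (metis smult_eq_iff smult_cancel)
qed

lemma height_poly_le:
  assumes "\<And>i. \<bar>coeff p i\<bar> \<le> X"
  shows "height_poly p \<le> X"
proof -
  have "0 \<le> X" using assms[of 0] by linarith
  thus ?thesis unfolding height_poly_def
    using assms by (subst Max_le_iff) (auto simp: coeffs_def)
qed

lemma height_poly_pos:
  assumes "p \<noteq> 0"
  shows "height_poly p > 0"
proof -
  have "lead_coeff p \<in> set (coeffs p)" using assms by (simp add: coeff_in_coeffs)
  hence "\<bar>lead_coeff p\<bar> \<le> height_poly p" unfolding height_poly_def by (intro Max_ge) auto
  thus ?thesis using assms by (smt (verit) leading_coeff_0_iff)
qed

section \<open>Sum of the absolute values of the coefficients\<close>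

text \<open>The sum is used in place of the maximum because it is submultiplicative and still bounds
  each coefficient. Evaluation at 1 makes it follow the recursion over \<open>pCons\<close>.\<close>

definition coeff_norm :: "'a :: real_normed_field poly \<Rightarrow> real" where
  "coeff_norm p = poly (map_poly norm p) 1"

lemma coeff_norm_0 [simp]: "coeff_norm 0 = 0"
  by (simp add: coeff_norm_def)

lemma coeff_norm_pCons [simp]: "coeff_norm (pCons a p) = norm a + coeff_norm p"
  by (simp add: coeff_norm_def map_poly_pCons)

lemma coeff_norm_1 [simp]: "coeff_norm 1 = 1"
  unfolding one_pCons by simp

lemma coeff_norm_nonneg: "coeff_norm p \<ge> 0"
  by (induction p) auto

lemma norm_coeff_le: "norm (coeff p i) \<le> coeff_norm p"
proof (induction p arbitrary: i)
  case (pCons a p)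
  thus ?case
    using pCons.IH coeff_norm_nonneg[of p]
    by (cases i) (auto intro: add_increasing)
qed simp

lemma coeff_norm_add: "coeff_norm (p + q) \<le> coeff_norm p + coeff_norm q"
proof (induction p q rule: poly_induct2)
  case (pCons a p b q)
  thus ?case using norm_triangle_ineq[of a b] by simp
qed simp

lemma coeff_norm_smult: "coeff_norm (smult c p) = norm c * coeff_norm p"
  by (induction p) (simp_all add: norm_mult algebra_simps)

lemma coeff_norm_mult: "coeff_norm (p * q) \<le> coeff_norm p * coeff_norm q"
proof (induction p)
  case (pCons a p)
  have "coeff_norm (pCons a p * q) \<le> coeff_norm (smult a q) + coeff_norm (pCons 0 (p * q))"
    unfolding mult_pCons_left by (rule coeff_norm_add)
  thus ?case using pCons.IH by (simp add: coeff_norm_smult algebra_simps)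
qed simp

lemma coeff_norm_power: "coeff_norm (p ^ n) \<le> coeff_norm p ^ n"
proof (induction n)
  case (Suc n)
  have "coeff_norm (p ^ Suc n) \<le> coeff_norm p * coeff_norm (p ^ n)"
    using coeff_norm_mult by simp
  also have "\<dots> \<le> coeff_norm p * coeff_norm p ^ n"
    using Suc coeff_norm_nonneg by (rule mult_left_mono)
  finally show ?case by simp
qed simp

lemma coeff_norm_sum: "coeff_norm (\<Sum>i\<in>I. f i) \<le> (\<Sum>i\<in>I. coeff_norm (f i))"
proof (induction I rule: infinite_finite_induct)
  case (insert x I)
  thus ?case using coeff_norm_add[of "f x" "\<Sum>i\<in>I. f i"] by simp
qed simp_all

section \<open>Binary forms in two linear polynomials\<close>

definition form :: "'a :: comm_ring_1 poly \<Rightarrow> 'a poly \<Rightarrow> (nat \<Rightarrow> 'a) \<Rightarrow> nat \<Rightarrow> 'a poly" where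
  "form L M c n = (\<Sum>i\<le>n. smult (c i) (L ^ i * M ^ (n - i)))"

lemma form_add: "form L M c n + form L M d n = form L M (\<lambda>i. c i + d i) n"
  by (simp add: form_def sum.distrib smult_add_left)

lemma form_smult: "smult a (form L M c n) = form L M (\<lambda>i. a * c i) n"
  using sum_distrib_left[of "[:a:]" "\<lambda>i. smult (c i) (L ^ i * M ^ (n - i))" "{..n}"]
  by (simp add: form_def mult.commute)

lemma form_mult_left: "L * form L M c n = form L M (\<lambda>i. case i of 0 \<Rightarrow> 0 | Suc j \<Rightarrow> c j) (Suc n)"
  unfolding form_def by (subst sum.atMost_Suc_shift) (simp add: sum_distrib_left mult.assoc)

lemma form_mult_right: "M * form L M c n = form L M (\<lambda>i. if i \<le> n then c i else 0) (Suc n)"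
  unfolding form_def
  by (auto simp: sum_distrib_left Suc_diff_le ac_simps intro!: sum.cong)

text \<open>The hypotheses express 1 and T as linear forms in \<open>L\<close> and \<open>M\<close>.
  Writing \<open>S = a + T * R\<close>, with \<open>a\<close> and \<open>R\<close> already forms of
  degree \<open>n\<close>, and multiplying by these linear forms raises the degree by one. No
  division occurs, so the argument gives integer coordinates as well as real ones.\<close>

lemma form_surj:
  fixes L M :: "'a :: comm_ring_1 poly"
  assumes one: "smult k L - smult q M = 1" and T: "smult h L - smult p M = [:0, 1:]"
    and "degree S \<le> n"
  shows "\<exists>c. S = form L M c n"
  using assms(3)
proof (induction n arbitrary: S)
  case 0
  then obtain a where "S = [:a:]" by (auto elim: degree_eq_zeroE)
  hence "S = form L M (\<lambda>_. a) 0" by (simp add: form_def)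
  thus ?case by blast
next
  case (Suc n)
  have step: "\<exists>c. (smult x L - smult y M) * form L M d n = form L M c (Suc n)" for x y d
  proof -
    have "(smult x L - smult y M) * form L M d n
        = smult x (L * form L M d n) + smult (- y) (M * form L M d n)"
      by (simp add: algebra_simps)
    thus ?thesis unfolding form_mult_left form_mult_right form_smult form_add by blast
  qed
  obtain a R where S: "S = pCons a R" by (rule pCons_cases)
  have "degree R \<le> n" using Suc.prems S by (cases "R = 0") auto
  then obtain d where d: "R = form L M d n" using Suc.IH by blast
  have "degree [:a:] \<le> n" by simp
  then obtain d' where d': "[:a:] = form L M d' n" using Suc.IH by blast
  have "S = 1 * form L M d' n + [:0, 1:] * form L M d n"
    unfolding d[symmetric] d'[symmetric] S by simp
  thus ?case using step[of k q d'] step[of h p d] form_add[of L M] unfolding one T by metis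
qed

lemma form_hom:
  fixes f :: "'a :: comm_ring_1 \<Rightarrow> 'b :: comm_ring_1"
  assumes "\<And>x y. f (x + y) = f x + f y" "\<And>x y. f (x * y) = f x * f y" "f 1 = 1"
  shows "map_poly f (form L M c n) = form (map_poly f L) (map_poly f M) (\<lambda>i. f (c i)) n"
  unfolding form_def by (simp add: map_poly_hom[of f, OF assms])

lemma coeff_norm_form:
  assumes "\<And>i. i \<le> n \<Longrightarrow> norm (c i) \<le> B" "coeff_norm L \<le> X" "coeff_norm M \<le> X"
  shows "coeff_norm (form L M c n) \<le> real (n + 1) * B * X ^ n"
proof -
  have X: "X \<ge> 0" using assms(2) coeff_norm_nonneg order_trans by blast
  have "coeff_norm (smult (c i) (L ^ i * M ^ (n - i))) \<le> B * X ^ n" if "i \<le> n" for i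
  proof -
    have "coeff_norm (L ^ i * M ^ (n - i)) \<le> coeff_norm (L ^ i) * coeff_norm (M ^ (n - i))"
      by (rule coeff_norm_mult)
    also have "\<dots> \<le> X ^ i * X ^ (n - i)"
      using assms X by (intro mult_mono order_trans[OF coeff_norm_power] power_mono)
        (auto simp: coeff_norm_nonneg)
    also have "\<dots> = X ^ n" using that by (simp flip: power_add)
    finally show ?thesis unfolding coeff_norm_smult
      using assms(1)[OF that] X by (intro mult_mono) (auto simp: coeff_norm_nonneg intro: order_trans[OF norm_ge_zero])
  qed
  hence "coeff_norm (form L M c n) \<le> (\<Sum>i\<le>n. B * X ^ n)"
    unfolding form_def by (intro order_trans[OF coeff_norm_sum] sum_mono) auto
  thus ?thesis by (simp add: algebra_simps)
qed

lemma degree_form: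
  assumes "degree L \<le> 1" "degree M \<le> 1"
  shows "degree (form L M c n) \<le> n"
  unfolding form_def
proof (intro degree_sum_le)
  fix i assume i: "i \<in> {..n}"
  have "degree (L ^ i * M ^ (n - i)) \<le> degree L * i + degree M * (n - i)"
    by (intro order_trans[OF degree_mult_le] add_mono degree_power_le)
  also have "\<dots> \<le> 1 * i + 1 * (n - i)" using assms by (intro add_mono mult_right_mono) auto
  finally show "degree (smult (c i) (L ^ i * M ^ (n - i))) \<le> n"
    using i by (intro order_trans[OF degree_smult_le]) auto
qed simp

lemma coeff_linear_mult_top:
  assumes "degree P \<le> m"
  shows "coeff ([:a, b:] * P) (Suc m) = b * coeff P m"
  using assms coeff_eq_0[of P "Suc m"] by (simp add: mult_pCons_left)

lemma coeff_linear_power_top: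
  "coeff ([:a, b:] ^ i * [:c, d:] ^ j) (i + j) = b ^ i * d ^ j"
proof (induction i)
  case 0
  show ?case
  proof (induction j)
    case (Suc j)
    have "degree ([:c, d:] ^ j) \<le> j"
      using degree_power_le[of "[:c, d:]" j] by (auto split: if_splits)
    thus ?case using Suc coeff_linear_mult_top[of "[:c, d:] ^ j" j c d] by simp
  qed simp
next
  case (Suc i)
  have "degree ([:a, b:] ^ i * [:c, d:] ^ j) \<le> degree ([:a, b:] ^ i) + degree ([:c, d:] ^ j)"
    by (rule degree_mult_le)
  also have "\<dots> \<le> i + j"
    using degree_power_le[of "[:a, b:]" i] degree_power_le[of "[:c, d:]" j]
    by (auto split: if_splits)
  finally show ?case
    using Suc coeff_linear_mult_top[of "[:a, b:] ^ i * [:c, d:] ^ j" "i + j" a b]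
    by (simp add: mult.assoc del: mult_pCons_left)
qed

lemma coeff_form_top:
  "coeff (form [:a, b:] [:c, d:] e n) n = (\<Sum>i\<le>n. e i * (b ^ i * d ^ (n - i)))"
proof -
  have "coeff ([:a, b:] ^ i * [:c, d:] ^ (n - i)) n = b ^ i * d ^ (n - i)" if "i \<le> n" for i
    using coeff_linear_power_top[of a b i c d "n - i"] that by simp
  thus ?thesis unfolding form_def by (simp add: coeff_sum)
qed

section \<open>Roots far from the approximated number\<close>

lemma norm_power_diff_le:
  fixes w x :: complex
  assumes "norm w \<le> r" "norm x \<le> r"
  shows "norm (w ^ Suc m - x ^ Suc m) \<le> real (Suc m) * r ^ m * norm (w - x)"
proof (induction m)
  case (Suc m)
  have r: "r \<ge> 0" using assms(1) norm_ge_zero order_trans by blast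
  have "w ^ Suc (Suc m) - x ^ Suc (Suc m) = w * (w ^ Suc m - x ^ Suc m) + (w - x) * x ^ Suc m"
    by (simp add: algebra_simps)
  also have "norm \<dots> \<le> norm w * norm (w ^ Suc m - x ^ Suc m) + norm (w - x) * norm x ^ Suc m"
    by (rule order_trans[OF norm_triangle_ineq]) (simp add: norm_mult norm_power)
  also have "\<dots> \<le> r * (real (Suc m) * r ^ m * norm (w - x)) + norm (w - x) * r ^ Suc m"
    using assms r Suc by (intro add_mono mult_mono power_mono) auto
  also have "\<dots> = real (Suc (Suc m)) * r ^ Suc m * norm (w - x)"
    by (simp add: algebra_simps)
  finally show ?case .
qed simp

text \<open>The sum is a polynomial in \<open>w\<close> without constant term whose linear
  coefficient is \<open>coeff g n\<close>, of norm at least 1. On a small disc the terms of higher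
  order have a Lipschitz constant below 1, so they cannot cancel the change of the linear
  term.\<close>

lemma reversed_poly_inj:
  fixes g :: "complex poly"
  assumes B: "\<And>j. norm (coeff g j) \<le> B" and top: "norm (coeff g n) \<ge> 1"
    and r: "norm w \<le> r" "norm x \<le> r" "r \<le> 1" "B * real ((n + 1)\<^sup>2) * r < 1"
    and eq: "(\<Sum>j\<le>n. coeff g j * w ^ (n + 1 - j)) = (\<Sum>j\<le>n. coeff g j * x ^ (n + 1 - j))"
  shows "w = x"
proof (rule ccontr)
  assume "w \<noteq> x"
  have r0: "r \<ge> 0" using r(1) norm_ge_zero order_trans by blast
  have B0: "B \<ge> 0" using B[of 0] norm_ge_zero order_trans by blast
  define D where "D j = coeff g j * (w ^ (n + 1 - j) - x ^ (n + 1 - j))" for j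
  have "(\<Sum>j\<le>n. D j) = 0" using eq by (simp add: D_def right_diff_distrib sum_subtractf)
  hence "(\<Sum>j<n. D j) + D n = 0" by (simp only: sum.lessThan_Suc flip: lessThan_Suc_atMost)
  hence D: "D n = - (\<Sum>j<n. D j)" by (metis add.inverse_unique)
  have le: "norm (D j) \<le> B * (real (n + 1) * r * norm (w - x))" if "j < n" for j
  proof -
    define m where "m = n - j - 1"
    \<comment> \<open>For \<open>j < n\<close> the exponent is at least 2, so a factor
      \<open>r\<close> remains after the further powers of \<open>r\<close> are bounded by
      1.\<close>
    have exponent: "n + 1 - j = Suc (Suc m)" using that by (simp add: m_def)
    have "norm (w ^ (n + 1 - j) - x ^ (n + 1 - j)) \<le> real (n + 1 - j) * r ^ (Suc m) * norm (w - x)"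
      unfolding exponent by (rule norm_power_diff_le[OF r(1,2)])
    also have "\<dots> \<le> real (n + 1) * r * norm (w - x)"
      using r r0 by (intro mult_right_mono mult_mono) (simp_all add: power_le_one mult_left_le)
    finally show ?thesis unfolding D_def norm_mult using B B0 by (intro mult_mono) auto
  qed
  have "1 * norm (w - x) \<le> norm (D n)" unfolding D_def norm_mult
    using top by (intro mult_mono) auto
  also have "\<dots> \<le> (\<Sum>j<n. norm (D j))" unfolding D using norm_sum by simp
  also have "\<dots> \<le> (\<Sum>j<n. B * (real (n + 1) * r * norm (w - x)))"
    using le by (intro sum_mono) auto
  also have "\<dots> = real n * (B * (real (n + 1) * r * norm (w - x)))" by simp
  also have "\<dots> \<le> real (n + 1) * (B * (real (n + 1) * r * norm (w - x)))"
    using B0 r0 by (intro mult_right_mono) auto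
  also have "\<dots> = (B * real ((n + 1)\<^sup>2) * r) * norm (w - x)"
    by (simp add: power2_eq_square algebra_simps)
  also have "\<dots> < 1 * norm (w - x)"
    using r(4) \<open>w \<noteq> x\<close> by (intro mult_strict_right_mono) auto
  finally show False by simp
qed

section \<open>Unimodular bases adapted to a good rational approximation\<close>

text \<open>Both linear polynomials \<open>q T - p\<close> and \<open>k T - h\<close> have
  coefficients of size O(k) and values of size O(1/k) at \<xi>.\<close>

definition approx_basis :: "real \<Rightarrow> int \<Rightarrow> int \<Rightarrow> int \<Rightarrow> int \<Rightarrow> bool" where
  "approx_basis \<xi> p q h k \<longleftrightarrow> q * h - k * p = 1 \<and> 0 \<le> q \<and> q \<le> k \<and> 0 < k \<and>
     \<bar>of_int k * \<xi> - of_int h\<bar> \<le> 1 / of_int k \<and> \<bar>of_int q * \<xi> - of_int p\<bar> \<le> 2 / of_int k"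

lemma approx_basis_exists:
  assumes "\<xi> \<notin> \<rat>"
  obtains p q h k where "approx_basis \<xi> p q h k" "X < real_of_int k"
proof -
  have "infinite (approx_set \<xi>)" using assms rational_iff_finite_approx_set by blast
  then obtain h k where hk: "(h, k) \<in> approx_set \<xi>" "k > \<lceil>X\<rceil>"
    using infinite_approx_set by blast
  hence cop: "coprime h k" and k: "k > 0" and "\<bar>\<xi> - of_int h / of_int k\<bar> < 1 / (of_int k)\<^sup>2"
    by (auto simp: approx_set_def)
  hence "of_int k * \<bar>\<xi> - of_int h / of_int k\<bar> \<le> of_int k * (1 / (of_int k)\<^sup>2)"
    by (intro mult_left_mono) auto
  also have "of_int k * \<bar>\<xi> - of_int h / of_int k\<bar> = \<bar>of_int k * \<xi> - of_int h\<bar>"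
    using k by (simp add: abs_mult_pos' right_diff_distrib)
  finally have approx: "\<bar>of_int k * \<xi> - of_int h\<bar> \<le> 1 / of_int k"
    using k by (simp add: power2_eq_square)
  obtain u v where uv: "u * h + v * k = 1"
    using bezout_int[of h k] cop by auto
  \<comment> \<open>Reducing the Bezout coefficient modulo \<open>k\<close> gives a \<open>q\<close>
    between 0 and \<open>k\<close>; the congruence \<open>q h = 1\<close> modulo \<open>k\<close> is
    kept and yields \<open>p\<close>.\<close>
  define q where "q = u mod k"
  have q: "0 \<le> q" "q \<le> k" using k by (auto simp: q_def intro: less_imp_le)
  have "k dvd q * h - 1"
  proof -
    have "q = u - k * (u div k)" by (simp add: q_def minus_mult_div_eq_mod)
    hence "q * h - 1 = u * h - k * (u div k) * h - (u * h + v * k)"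
      unfolding uv by (simp add: left_diff_distrib)
    also have "\<dots> = k * (- v - (u div k) * h)" by (simp add: algebra_simps)
    finally show ?thesis by simp
  qed
  then obtain p where "q * h - 1 = k * p" by (elim dvdE)
  hence det: "q * h - k * p = 1" by simp
  \<comment> \<open>The determinant is the last summand. Since \<open>q\<close> is at most
    \<open>k\<close>, the first summand is at most 1 in absolute value, whence the constant
    2.\<close>
  have "of_int k * (of_int q * \<xi> - of_int p) = of_int q * (of_int k * \<xi> - of_int h) + of_int (q * h - k * p)"
    by (simp add: algebra_simps)
  hence "\<bar>of_int k * (of_int q * \<xi> - of_int p)\<bar> \<le> \<bar>of_int q * (of_int k * \<xi> - of_int h)\<bar> + 1"
    unfolding det by simp
  hence "of_int k * \<bar>of_int q * \<xi> - of_int p\<bar> \<le> of_int q * \<bar>of_int k * \<xi> - of_int h\<bar> + 1"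
    using k q by (simp add: abs_mult)
  also have "\<dots> \<le> of_int k * (1 / of_int k) + 1"
    using q k approx by (intro add_mono mult_mono) auto
  finally have "\<bar>of_int q * \<xi> - of_int p\<bar> \<le> 2 / of_int k" using k by (simp add: field_simps)
  hence "approx_basis \<xi> p q h k" using det q k approx by (simp add: approx_basis_def)
  moreover have "X < real_of_int k" using hk(2) by linarith
  ultimately show ?thesis by (rule that)
qed

text \<open>The factor \<open>(n + 1) * 5 * 3 ^ n\<close> bounds the coefficients of a form with
  coordinates at most 5 in linear polynomials of coefficient norm at most 3. Times
  \<open>(n + 1)\<^sup>2\<close> it is the quantity in \<open>reversed_poly_inj\<close>, and the
  added 1 makes the inequality there strict for the radius \<open>1 / root_const n\<close>.\<close>

definition root_const :: "nat \<Rightarrow> real" where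
  "root_const n = real (n + 1) * 5 * 3 ^ n * real ((n + 1)\<^sup>2) + 1"

lemma poly_form: "poly (form L M c n) z = (\<Sum>i\<le>n. c i * (poly L z ^ i * poly M z ^ (n - i)))"
  by (simp add: form_def poly_sum)

text \<open>
  In the coordinate \<open>u = k\<^sup>2 (z - \<xi>)\<close> both linear factors, multiplied by \<open>k\<close>, have bounded
  coefficients. So far roots correspond to zeros of the reversed polynomial in a fixed disc
  around 0 in which it is injective; for \<open>\<rho> = 0\<close> the point 0 itself is such a zero.
\<close>
lemma far_roots:
  fixes \<rho> :: complex and e :: "nat \<Rightarrow> real"
  assumes basis: "approx_basis \<xi> p q h k"
    and e: "\<And>i. 1 \<le> e i" "\<And>i. e i \<le> 5"
    and Q: "Q = smult \<rho> ([:- of_real \<xi>, 1:] ^ (n + 1)) +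
              form [:- of_int p, of_int q:] [:- of_int h, of_int k:] (\<lambda>i. of_real (e i)) n"
    and z: "poly Q z = 0" "cmod (of_real \<xi> - z) > root_const n / (of_int k)\<^sup>2"
  shows "\<rho> \<noteq> 0"
    and "poly Q w = 0 \<Longrightarrow> cmod (of_real \<xi> - w) > root_const n / (of_int k)\<^sup>2 \<Longrightarrow> w = z"
proof -
  have k: "k > 0" and q: "0 \<le> q" "q \<le> k" using basis by (auto simp: approx_basis_def)
  \<comment> \<open>With \<open>u = k\<^sup>2 (z - \<xi>)\<close> one has
    \<open>k (q z - p) = a + b u\<close> and \<open>k (k z - h) = d + u\<close>.\<close>
  define a b d :: real where "a = of_int k * (of_int q * \<xi> - of_int p)"
    and "b = of_int q / of_int k" and "d = of_int k * (of_int k * \<xi> - of_int h)"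
  define g :: "complex poly" where
    "g = form [:of_real a, of_real b:] [:of_real d, 1:] (\<lambda>i. of_real (e i)) n"
  \<comment> \<open>This is the coefficient of \<open>u ^ (n + 1)\<close> once the equation
    \<open>Q = 0\<close> has been multiplied by \<open>k ^ n\<close>. Dividing that equation by
    \<open>u ^ (n + 1)\<close> turns it into \<open>rev (1 / u) = - \<eta>\<close>.\<close>
  define \<eta> where "\<eta> = \<rho> * of_int k ^ n / (of_int k ^ 2) ^ (n + 1)"
  define rev where "rev x = (\<Sum>j\<le>n. coeff g j * x ^ (n + 1 - j))" for x
  define inv where "inv z = 1 / (of_int k ^ 2 * (z - complex_of_real \<xi>))" for z
  define r where "r = 1 / root_const n"
  have b: "0 \<le> b" "b \<le> 1" using k q by (auto simp: b_def)
  have "of_int k * \<bar>of_int q * \<xi> - of_int p\<bar> \<le> of_int k * (2 / of_int k)"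
       "of_int k * \<bar>of_int k * \<xi> - of_int h\<bar> \<le> of_int k * (1 / of_int k)"
    using basis by (intro mult_left_mono; simp add: approx_basis_def)+
  hence a: "\<bar>a\<bar> \<le> 2" and d: "\<bar>d\<bar> \<le> 1"
    using k by (simp_all add: a_def d_def abs_mult)
  have C: "root_const n \<ge> 1" by (simp add: root_const_def)

  have coeff_le: "norm (coeff g j) \<le> real (n + 1) * 5 * 3 ^ n" for j
  proof -
    have "norm (coeff g j) \<le> coeff_norm g" by (rule norm_coeff_le)
    also have "\<dots> \<le> real (n + 1) * 5 * 3 ^ n"
      unfolding g_def using e a b d
      by (intro coeff_norm_form) (auto simp: order_trans[OF zero_le_one])
    finally show ?thesis .
  qed
  \<comment> \<open>The lower bound on the coordinates enters here: all summands are nonnegative and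
    the one with index 0 is at least 1.\<close>
  have "coeff g n = of_real (\<Sum>i\<le>n. e i * b ^ i)"
    unfolding g_def coeff_form_top by simp
  moreover have "e 0 * b ^ 0 \<le> (\<Sum>i\<le>n. e i * b ^ i)"
    using b order_trans[OF zero_le_one e(1)] by (intro member_le_sum mult_nonneg_nonneg) auto
  ultimately have top: "norm (coeff g n) \<ge> 1"
    using e(1)[of 0] by (metis abs_ge_self mult.right_neutral norm_of_real order_trans power_0)
  have "degree g \<le> n" unfolding g_def by (intro degree_form) auto
  have poly_g: "poly g u = (\<Sum>j\<le>n. coeff g j * u ^ j)" for u
    unfolding poly_altdef using \<open>degree g \<le> n\<close>
    by (intro sum.mono_neutral_left) (auto simp: coeff_eq_0)

  have far: "norm (inv z) \<le> r \<and> inv z \<noteq> 0 \<and> rev (inv z) = - \<eta>"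
    if z: "poly Q z = 0" "cmod (of_real \<xi> - z) > root_const n / (of_int k)\<^sup>2" for z
  proof -
    define u where "u = of_int k ^ 2 * (z - complex_of_real \<xi>)"
    have "cmod (z - of_real \<xi>) > root_const n / (of_int k)\<^sup>2"
      using z(2) by (simp add: norm_minus_commute)
    hence "root_const n < (of_int k)\<^sup>2 * cmod (z - of_real \<xi>)" using k by (simp add: field_simps)
    hence u: "root_const n < norm u" by (simp add: u_def norm_mult norm_power)
    hence u0: "u \<noteq> 0" using C by auto
    have inv: "inv z = 1 / u" by (simp add: inv_def u_def)
    have "norm (inv z) \<le> r" unfolding inv r_def using u C by (simp add: norm_divide frac_le)
    have L: "of_int k * poly [:- of_int p, of_int q:] z = poly [:of_real a, of_real b:] u"
    proof -
      have "of_real b * (of_int k :: complex) = of_int q" using k by (simp add: b_def)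
      moreover have "u * of_real b = of_int k * (z - of_real \<xi>) * (of_real b * of_int k)"
        unfolding u_def power2_eq_square by (simp only: ac_simps)
      ultimately have "u * of_real b = of_int k * (z - of_real \<xi>) * of_int q" by simp
      thus ?thesis by (simp add: a_def algebra_simps)
    qed
    have M: "of_int k * poly [:- of_int h, of_int k:] z = poly [:of_real d, 1:] u"
      by (simp add: d_def u_def algebra_simps power2_eq_square)
    have "of_int k ^ n * poly (form [:- of_int p, of_int q:] [:- of_int h, of_int k:] (\<lambda>i. of_real (e i)) n) z
        = poly g u"
      unfolding g_def poly_form sum_distrib_left
    proof (intro sum.cong refl)
      fix i assume "i \<in> {..n}"
      hence "(of_int k :: complex) ^ n = of_int k ^ i * of_int k ^ (n - i)"
        by (simp flip: power_add)
      thus "of_int k ^ n * (complex_of_real (e i) * (poly [:- of_int p, of_int q:] z ^ i * poly [:- of_int h, of_int k:] z ^ (n - i)))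
         = of_real (e i) * (poly [:of_real a, of_real b:] u ^ i * poly [:of_real d, 1:] u ^ (n - i))"
        unfolding L[symmetric] M[symmetric] power_mult_distrib by (simp add: ac_simps)
    qed
    moreover have "of_int k ^ n * (\<rho> * (z - of_real \<xi>) ^ (n + 1)) = \<eta> * u ^ (n + 1)"
      using k by (simp add: \<eta>_def u_def power_mult_distrib)
    moreover have "of_int k ^ n * poly Q z = 0" using z by simp
    ultimately have "\<eta> * u ^ (n + 1) + poly g u = 0"
      unfolding Q by (simp add: algebra_simps)
    hence "(\<eta> * u ^ (n + 1) + poly g u) / u ^ (n + 1) = 0" by simp
    hence "\<eta> + (\<Sum>j\<le>n. coeff g j * u ^ j / u ^ (n + 1)) = 0"
      using u0 by (simp add: add_divide_distrib poly_g sum_divide_distrib)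
    also have "(\<Sum>j\<le>n. coeff g j * u ^ j / u ^ (n + 1)) = rev (inv z)"
      unfolding rev_def inv
    proof (intro sum.cong refl)
      fix j assume "j \<in> {..n}"
      hence "u ^ (n + 1) = u ^ j * u ^ (n + 1 - j)" by (subst power_add[symmetric]) simp
      thus "coeff g j * u ^ j / u ^ (n + 1) = coeff g j * (1 / u) ^ (n + 1 - j)"
        using u0 by (simp add: power_one_over)
    qed
    finally have "rev (inv z) = - \<eta>" by (metis add.inverse_unique)
    with \<open>norm (inv z) \<le> r\<close> u0 show ?thesis by (simp add: inv)
  qed
  have r: "r \<le> 1" "r \<ge> 0" "real (n + 1) * 5 * 3 ^ n * real ((n + 1)\<^sup>2) * r < 1"
  proof -
    show "r \<le> 1" "r \<ge> 0" using C by (simp_all add: r_def)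
    have "real (n + 1) * 5 * 3 ^ n * real ((n + 1)\<^sup>2) * r = (root_const n - 1) / root_const n"
      by (simp add: r_def root_const_def)
    also have "\<dots> < 1" using C by simp
    finally show "real (n + 1) * 5 * 3 ^ n * real ((n + 1)\<^sup>2) * r < 1" .
  qed
  have inj: "x = y" if "norm x \<le> r" "norm y \<le> r" "rev x = rev y" for x y
    using reversed_poly_inj[OF coeff_le top that(1,2) r(1,3)] that(3) unfolding rev_def by blast
  show "\<rho> \<noteq> 0"
  proof
    assume "\<rho> = 0"
    hence "rev (inv z) = rev 0" using far[OF z] by (simp add: \<eta>_def rev_def Suc_diff_le)
    thus False using inj[of "inv z" 0] far[OF z] r by simp
  qed
  assume w: "poly Q w = 0" "cmod (of_real \<xi> - w) > root_const n / (of_int k)\<^sup>2"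
  have "inv w = inv z" using inj far[OF z] far[OF w] by simp
  thus "w = z" using far[OF z] far[OF w] k by (simp add: inv_def)
qed

section \<open>Construction of the polynomials\<close>

text \<open>Adding \<open>4 Z\<close> to \<open>B\<close> shifts each coordinate by an arbitrary
  multiple of 4, and every closed interval of length 4 contains a number of the resulting
  progression. The residue of \<open>F\<close> modulo 4 remains that of \<open>B\<close>.\<close>

lemma approx_basis_form_exists:
  fixes A :: "real poly" and B :: "int poly"
  assumes basis: "approx_basis \<xi> p q h k" and A: "degree A \<le> n" and B: "degree B \<le> n"
  obtains F Z :: "int poly" and e :: "nat \<Rightarrow> real"
  where "degree Z \<le> n" "F = B + smult 4 Z" "\<And>i. 1 \<le> e i" "\<And>i. e i \<le> 5"
    and "map_poly of_int F + A = form [:- of_int p, of_int q:] [:- of_int h, of_int k:] e n"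
proof -
  define L M :: "int poly" where "L = [:- p, q:]" and "M = [:- h, k:]"
  define L' M' :: "real poly" where "L' = [:- of_int p, of_int q:]" and "M' = [:- of_int h, of_int k:]"
  have det: "q * h - k * p = 1" using basis by (simp add: approx_basis_def)
  hence det': "of_int q * of_int h - of_int k * of_int p = (1 :: real)"
    by (metis of_int_1 of_int_diff of_int_mult)
  have "smult k L - smult q M = 1" "smult h L - smult p M = [:0, 1:]"
    using det by (simp_all add: L_def M_def one_pCons algebra_simps)
  from form_surj[OF this B] obtain s where s: "B = form L M s n" by blast
  have "smult (of_int k) L' - smult (of_int q) M' = 1"
       "smult (of_int h) L' - smult (of_int p) M' = [:0, 1:]"
    using det' by (simp_all add: L'_def M'_def one_pCons algebra_simps)
  from form_surj[OF this A] obtain r where r: "A = form L' M' r n" by blast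
  \<comment> \<open>The least integer for which the coordinate \<open>s i + 4 * m i + r i\<close>
    reaches 1.\<close>
  define m where "m i = \<lceil>(1 - r i - of_int (s i)) / 4\<rceil>" for i
  define e where "e i = of_int (s i + 4 * m i) + r i" for i
  have m: "(1 - r i - of_int (s i)) / 4 \<le> of_int (m i)"
          "of_int (m i) \<le> (1 - r i - of_int (s i)) / 4 + 1" for i
    unfolding m_def by linarith+
  have e: "1 \<le> e i" "e i \<le> 5" for i
  proof -
    have "e i = of_int (s i) + 4 * of_int (m i) + r i" by (simp add: e_def)
    with m[of i] show "1 \<le> e i" and "e i \<le> 5" by (auto simp: field_simps)
  qed
  have maps: "map_poly of_int L = L'" "map_poly of_int M = M'"
    by (simp_all add: L_def M_def L'_def M'_def map_poly_pCons)
  have "map_poly of_int (B + smult 4 (form L M m n)) + A = form L' M' e n"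
    unfolding s r form_smult form_add e_def
    by (simp add: form_hom[of of_int, OF of_int_add of_int_mult of_int_1] maps form_add)
  moreover have "degree (form L M m n) \<le> n"
    by (intro degree_form) (auto simp: L_def M_def)
  ultimately show ?thesis using e that unfolding L'_def M'_def by blast
qed

text \<open>The first summand accounts for \<open>(T - \<xi>)\<^sup>n\<^sup>+\<^sup>1\<close>, the
  second for a form with coordinates at most 5 in linear polynomials of coefficient norm at most
  \<open>(\<bar>\<xi>\<bar> + 3) k\<close>.\<close>

definition height_const :: "real \<Rightarrow> nat \<Rightarrow> real" where
  "height_const \<xi> n = (1 + \<bar>\<xi>\<bar>) ^ (n + 1) + real (n + 1) * 5 * (\<bar>\<xi>\<bar> + 3) ^ n"

lemma height_const_pos: "height_const \<xi> n > 0"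
proof -
  have "1 + \<bar>\<xi>\<bar> > 0" "\<bar>\<xi>\<bar> + 3 > 0" by linarith+
  hence "(1 + \<bar>\<xi>\<bar>) ^ (n + 1) > 0" "real (n + 1) * 5 * (\<bar>\<xi>\<bar> + 3) ^ n > 0" by simp_all
  thus ?thesis unfolding height_const_def by linarith
qed

text \<open>The parameter \<rho> covers both constructions at once, with value 0 for conjugates that
  all lie near \<xi> and value 1 for the monic case.\<close>

lemma approx_basis_coeff_le:
  assumes basis: "approx_basis \<xi> p q h k"
    and e: "\<And>i. 1 \<le> e i" "\<And>i. e i \<le> 5" and \<rho>: "\<bar>\<rho>\<bar> \<le> 1"
    and Q: "Q = smult \<rho> ([:- \<xi>, 1:] ^ (n + 1)) +
              form [:- of_int p, of_int q:] [:- of_int h, of_int k:] e n"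
  shows "\<bar>coeff Q i\<bar> \<le> height_const \<xi> n * of_int k ^ n"
proof -
  have k: "1 \<le> real_of_int k" and q: "0 \<le> q" "real_of_int q \<le> of_int k"
    using basis by (auto simp: approx_basis_def)
  have inv: "1 / of_int k \<le> real_of_int k"
    using k by (simp add: divide_le_eq order_trans[OF _ mult_mono[of 1 _ 1]])
  have "\<bar>of_int p\<bar> \<le> \<bar>of_int q * \<xi>\<bar> + \<bar>of_int q * \<xi> - real_of_int p\<bar>" by linarith
  also have "\<dots> \<le> of_int k * \<bar>\<xi>\<bar> + 2 * of_int k"
    using basis q inv k unfolding abs_mult
    by (intro add_mono mult_right_mono) (auto simp: approx_basis_def intro: order_trans)
  finally have L: "coeff_norm [:- of_int p, real_of_int q:] \<le> (\<bar>\<xi>\<bar> + 3) * of_int k"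
    using q by (simp add: algebra_simps)
  have "\<bar>of_int h\<bar> \<le> \<bar>of_int k * \<xi>\<bar> + \<bar>of_int k * \<xi> - real_of_int h\<bar>" by linarith
  also have "\<dots> \<le> of_int k * \<bar>\<xi>\<bar> + of_int k"
    using basis inv k unfolding abs_mult
    by (intro add_mono mult_right_mono) (auto simp: approx_basis_def intro: order_trans)
  finally have M: "coeff_norm [:- of_int h, real_of_int k:] \<le> (\<bar>\<xi>\<bar> + 3) * of_int k"
    using k by (simp add: algebra_simps)
  have "coeff_norm (form [:- of_int p, of_int q:] [:- of_int h, of_int k:] e n)
      \<le> real (n + 1) * 5 * ((\<bar>\<xi>\<bar> + 3) * of_int k) ^ n"
    using e L M by (intro coeff_norm_form) (auto intro: order_trans[OF _ e(1)] simp: abs_le_iff order_trans[OF _ e(1)])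
  moreover have "coeff_norm (smult \<rho> ([:- \<xi>, 1:] ^ (n + 1))) \<le> (1 + \<bar>\<xi>\<bar>) ^ (n + 1) * of_int k ^ n"
  proof -
    have "coeff_norm (smult \<rho> ([:- \<xi>, 1:] ^ (n + 1))) \<le> 1 * coeff_norm [:- \<xi>, 1:] ^ (n + 1)"
      unfolding coeff_norm_smult using \<rho>
      by (intro mult_mono coeff_norm_power) (auto simp: coeff_norm_nonneg)
    also have "\<dots> = (1 + \<bar>\<xi>\<bar>) ^ (n + 1) * 1" by (simp add: add.commute)
    also have "\<dots> \<le> (1 + \<bar>\<xi>\<bar>) ^ (n + 1) * of_int k ^ n"
      using k by (intro mult_left_mono one_le_power) auto
    finally show ?thesis .
  qed
  ultimately have "coeff_norm Q \<le> (1 + \<bar>\<xi>\<bar>) ^ (n + 1) * of_int k ^ n +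
      real (n + 1) * 5 * ((\<bar>\<xi>\<bar> + 3) * of_int k) ^ n"
    unfolding Q by (intro order_trans[OF coeff_norm_add] add_mono)
  also have "\<dots> = height_const \<xi> n * of_int k ^ n"
    unfolding height_const_def power_mult_distrib by (simp only: distrib_right mult.assoc)
  finally show ?thesis using norm_coeff_le[of Q i] by simp
qed

text \<open>All summands are nonnegative and the one with index 0 is at least \<open>k ^ n\<close>.
  This fixes degree and sign in the first construction, and separates the polynomials for different
  \<open>k\<close> in the second.\<close>

lemma coeff_form_top_ge:
  assumes "approx_basis \<xi> p q h k" "\<And>i. 1 \<le> e i" "n > 0"
  shows "coeff (form [:- of_int p, of_int q:] [:- of_int h, of_int k:] e n) n \<ge> real_of_int k"
proof -
  have k: "1 \<le> real_of_int k" and q: "0 \<le> q" using assms(1) by (auto simp: approx_basis_def)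
  have e: "0 \<le> e i" for i using order_trans[OF zero_le_one assms(2)] .
  have "real_of_int k ^ 1 \<le> of_int k ^ n" using assms(3) k by (intro power_increasing) auto
  also have "\<dots> \<le> e 0 * (of_int q ^ 0 * of_int k ^ (n - 0))"
    using assms(2)[of 0] k by simp
  also have "\<dots> \<le> (\<Sum>i\<le>n. e i * (of_int q ^ i * of_int k ^ (n - i)))"
    using e q k by (intro member_le_sum mult_nonneg_nonneg) auto
  finally show ?thesis by (simp add: coeff_form_top)
qed

lemma map_poly_of_real_of_int:
  "map_poly (of_real :: real \<Rightarrow> complex) (map_poly of_int p) = map_poly of_int p"
  by (simp add: map_poly_map_poly o_def)

lemma complex_form:
  assumes "map_poly of_int P = smult \<rho> ([:- \<xi>, 1:] ^ m) +
             form [:- of_int p, of_int q:] [:- of_int h, of_int k:] e n"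
  shows "map_poly of_int P = smult (of_real \<rho>) ([:- complex_of_real \<xi>, 1:] ^ m) +
             form [:- of_int p, of_int q:] [:- of_int h, of_int k:] (\<lambda>i. of_real (e i)) n"
proof -
  have "map_poly of_int P = map_poly complex_of_real (map_poly of_int P)"
    by (simp only: map_poly_of_real_of_int)
  thus ?thesis unfolding assms
    by (simp add: map_poly_of_real_hom map_poly_pCons
        form_hom[of of_real, OF of_real_add of_real_mult of_real_1])
qed

section \<open>The two families of Eisenstein polynomials\<close>

lemma conjugate_cluster_poly:
  assumes basis: "approx_basis \<xi> p q h k" and n: "n > 0"
  obtains P :: "int poly" where "irreducible P" "degree P = n" "lead_coeff P > 0"
    and "\<And>i. \<bar>of_int (coeff P i)\<bar> \<le> height_const \<xi> n * of_int k ^ n"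
    and "\<And>z. poly (map_poly of_int P) z = 0 \<Longrightarrow>
           cmod (of_real \<xi> - z) \<le> root_const n / (of_int k)\<^sup>2"
proof -
  have "degree (0 :: real poly) \<le> n" by simp
  \<comment> \<open>The residue \<open>T ^ n + 2\<close> modulo 4 carries the parity and
    divisibility conditions of Eisenstein's criterion.\<close>
  moreover have "degree (monom 1 n + [:2:] :: int poly) \<le> n"
    by (intro degree_add_le degree_monom_le) simp
  ultimately obtain F Z :: "int poly" and e :: "nat \<Rightarrow> real" where Z: "degree Z \<le> n"
    and F: "F = (monom 1 n + [:2:]) + smult 4 Z" and e: "\<And>i. 1 \<le> e i" "\<And>i. e i \<le> 5"
    and "map_poly of_int F + 0 = form [:- of_int p, of_int q:] [:- of_int h, of_int k:] e n"
    by (rule approx_basis_form_exists[OF basis]) blast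
  hence form: "map_poly of_int F = smult 0 ([:- \<xi>, 1:] ^ (n + 1)) +
                 form [:- of_int p, of_int q:] [:- of_int h, of_int k:] e n" by simp
  have "real_of_int (coeff F n) \<ge> of_int k"
    using coeff_form_top_ge[OF basis e(1) n] arg_cong[OF form, of "\<lambda>f. coeff f n"]
    by (simp add: coeff_map_poly)
  hence top: "coeff F n > 0" using basis by (simp add: approx_basis_def)
  have "degree F \<le> n" unfolding F using Z
    by (intro degree_add_le degree_monom_le) (auto intro: order_trans[OF degree_smult_le])
  hence deg: "degree F = n" using top by (intro antisym le_degree) auto
  have F0: "F \<noteq> 0" using top by auto
  \<comment> \<open>\<open>F\<close> need not be primitive. Its content divides an odd leading
    coefficient, so it is odd and dividing by it preserves the Eisenstein conditions; the
    coefficients do not grow and the roots stay the same.\<close>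
  define c P where "c = Polynomial.content F" and "P = primitive_part F"
  have FP: "F = smult c P" by (simp add: c_def P_def)
  have c: "c > 0" using F0 unfolding c_def
    by (metis abs_ge_zero content_eq_zero_iff normalize_content normalize_int_def order_less_le)
  have coeff: "coeff F i = c * coeff P i" for i unfolding FP by simp
  have degP: "degree P = n" by (simp add: P_def deg)
  have odd: "odd (coeff F n)" using n by (cases n) (simp_all add: F)
  have even: "even (coeff F i)" if "i < n" for i
    using that by (simp add: F coeff_pCons split: nat.split)
  have four: "\<not> 4 dvd coeff F 0"
  proof
    assume "4 dvd coeff F 0"
    hence "4 dvd coeff F 0 - 4 * coeff Z 0" by simp
    also have "coeff F 0 - 4 * coeff Z 0 = 2" using n by (simp add: F)
    finally show False by simp
  qed
  have irred: "irreducible P"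
  proof (rule eisenstein_two)
    show "degree P > 0" using degP n by simp
    show "odd (lead_coeff P)" using odd by (simp add: coeff degP)
    show "even (coeff P i)" if "i < degree P" for i
      using even[of i] odd that by (simp add: coeff degP)
    show "\<not> 4 dvd coeff P 0" using four by (auto simp: coeff)
    show "Polynomial.content P = 1" using F0 by (simp add: P_def)
  qed
  have lead: "lead_coeff P > 0" using top c by (simp add: coeff degP zero_less_mult_iff)
  have bound: "\<bar>of_int (coeff P i)\<bar> \<le> height_const \<xi> n * of_int k ^ n" for i
  proof -
    have "1 * \<bar>coeff P i\<bar> \<le> c * \<bar>coeff P i\<bar>" using c by (intro mult_right_mono) auto
    hence "\<bar>coeff P i\<bar> \<le> \<bar>coeff F i\<bar>" using c by (simp add: coeff abs_mult)
    hence "\<bar>real_of_int (coeff P i)\<bar> \<le> \<bar>coeff (map_poly of_int F) i\<bar>"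
      by (simp add: coeff_map_poly flip: of_int_abs)
    also have "\<dots> \<le> height_const \<xi> n * of_int k ^ n"
      by (rule approx_basis_coeff_le[OF basis e _ form]) simp
    finally show ?thesis .
  qed
  have root: "cmod (of_real \<xi> - z) \<le> root_const n / (of_int k)\<^sup>2" if "poly (map_poly of_int P) z = 0" for z
  proof (rule ccontr)
    assume far: "\<not> ?thesis"
    have "poly (map_poly of_int F) z = 0" unfolding FP using that by (simp add: map_poly_of_int_hom)
    thus False using far_roots(1)[OF basis e complex_form[OF form], of z] far by simp
  qed
  show ?thesis by (rule that[OF irred degP lead bound root])
qed

text \<open>Here the polynomial is monic, hence primitive, and its residue modulo 4 is
  \<open>T ^ (n + 1) + 2\<close>. The lower bound for the coefficient of \<open>T ^ n\<close> serves
  to show that infinitely many polynomials arise.\<close>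

lemma almost_conjugate_cluster_poly:
  assumes basis: "approx_basis \<xi> p q h k" and n: "n > 0"
  obtains Q :: "int poly" where "irreducible Q" "degree Q = n + 1" "lead_coeff Q = 1"
    and "real_of_int (coeff Q n) \<ge> of_int k - real (n + 1) * \<bar>\<xi>\<bar>"
    and "\<And>i. \<bar>of_int (coeff Q i)\<bar> \<le> height_const \<xi> n * of_int k ^ n"
    and "\<And>z w. poly (map_poly of_int Q) z = 0 \<Longrightarrow> poly (map_poly of_int Q) w = 0 \<Longrightarrow>
           cmod (of_real \<xi> - z) > root_const n / (of_int k)\<^sup>2 \<Longrightarrow>
           cmod (of_real \<xi> - w) > root_const n / (of_int k)\<^sup>2 \<Longrightarrow> w = z"
proof -
  define A where "A = monom 1 (n + 1) - [:- \<xi>, 1:] ^ (n + 1)"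
  \<comment> \<open>The leading terms cancel, so \<open>A\<close> is a form of degree
    \<open>n\<close> in the two linear polynomials.\<close>
  have "coeff A i = 0" if "i > n" for i
  proof (cases "i = n + 1")
    case True
    have "coeff ([:- \<xi>, 1:] ^ (n + 1)) (n + 1) = 1" by (rule coeff_linear_power)
    thus ?thesis unfolding A_def coeff_diff True by simp
  next
    case False
    hence "degree ([:- \<xi>, 1:] ^ (n + 1)) < i" unfolding degree_linear_power using that by simp
    hence "coeff ([:- \<xi>, 1:] ^ (n + 1)) i = 0" by (rule coeff_eq_0)
    thus ?thesis unfolding A_def coeff_diff using False by simp
  qed
  hence "degree A \<le> n" by (intro degree_le) auto
  moreover have "degree ([:2:] :: int poly) \<le> n" by simp
  ultimately obtain F Z :: "int poly" and e :: "nat \<Rightarrow> real" where Z: "degree Z \<le> n"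
    and F: "F = [:2:] + smult 4 Z" and e: "\<And>i. 1 \<le> e i" "\<And>i. e i \<le> 5"
    and A: "map_poly of_int F + A = form [:- of_int p, of_int q:] [:- of_int h, of_int k:] e n"
    by (rule approx_basis_form_exists[OF basis]) blast
  define Q where "Q = monom 1 (n + 1) + F"
  have form: "map_poly of_int Q = smult 1 ([:- \<xi>, 1:] ^ (n + 1)) +
                 form [:- of_int p, of_int q:] [:- of_int h, of_int k:] e n"
    unfolding A[symmetric] A_def Q_def by (simp add: map_poly_of_int_hom map_poly_monom)
  have degF: "degree F \<le> n" unfolding F using Z
    by (intro degree_add_le) (auto intro: order_trans[OF degree_smult_le])
  hence deg: "degree Q = n + 1" unfolding Q_def
    by (subst degree_add_eq_left) (auto simp: degree_monom_eq)
  have lead: "lead_coeff Q = 1" unfolding deg using degF by (simp add: Q_def coeff_eq_0)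
  have even: "even (coeff Q i)" if "i < n + 1" for i
    using that by (simp add: Q_def F coeff_pCons split: nat.split)
  have four: "\<not> 4 dvd coeff Q 0"
  proof
    assume "4 dvd coeff Q 0"
    hence "4 dvd coeff Q 0 - 4 * coeff Z 0" by simp
    also have "coeff Q 0 - 4 * coeff Z 0 = 2" by (simp add: Q_def F)
    finally show False by simp
  qed
  have irred: "irreducible Q"
  proof (rule eisenstein_two)
    show "odd (lead_coeff Q)" unfolding lead by simp
    have "Polynomial.content Q dvd 1" using content_dvd_coeff[of Q "degree Q"] lead by simp
    thus "Polynomial.content Q = 1" by (metis is_unit_normalize normalize_content)
  qed (use deg even four in auto)
  have "coeff ([:- \<xi>, 1:] ^ (n + 1)) n = - (real (n + 1) * \<xi>)"
    by (subst coeff_linear_poly_power) auto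
  hence "real_of_int (coeff Q n) = - (real (n + 1) * \<xi>) +
      coeff (form [:- of_int p, of_int q:] [:- of_int h, of_int k:] e n) n"
    using arg_cong[OF form, of "\<lambda>f. coeff f n"] by (simp add: coeff_map_poly del: power_Suc)
  also have "\<dots> \<ge> - (real (n + 1) * \<bar>\<xi>\<bar>) + of_int k"
    by (intro add_mono le_imp_neg_le mult_left_mono coeff_form_top_ge[OF basis e(1) n]) auto
  finally have top: "real_of_int (coeff Q n) \<ge> of_int k - real (n + 1) * \<bar>\<xi>\<bar>"
    by simp
  have bound: "\<bar>of_int (coeff Q i)\<bar> \<le> height_const \<xi> n * of_int k ^ n" for i
    using approx_basis_coeff_le[OF basis e _ form, of i] by (simp add: coeff_map_poly)
  have root: "w = z" if "poly (map_poly of_int Q) z = 0" "poly (map_poly of_int Q) w = 0"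
      "cmod (of_real \<xi> - z) > root_const n / (of_int k)\<^sup>2"
      "cmod (of_real \<xi> - w) > root_const n / (of_int k)\<^sup>2" for z w
    using far_roots(2)[OF basis e complex_form[OF form] that(1,3,2,4)] .
  show ?thesis by (rule that[OF irred deg lead top bound root])
qed

section \<open>Heights and infinitude\<close>

text \<open>If \<xi> were the only root, the polynomial would be \<open>a (T - \<xi>) ^ m\<close>;
  its coefficient of \<open>T ^ (m - 1)\<close> is \<open>- a m \<xi>\<close>, an integer, which
  makes \<xi> rational. The lemma matters when \<xi> is itself algebraic.\<close>

lemma exists_root_neq_irrational:
  fixes P :: "int poly"
  assumes "\<xi> \<notin> \<rat>" "degree P > 0"
  shows "\<exists>z. poly (map_poly of_int P) z = 0 \<and> z \<noteq> complex_of_real \<xi>"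
proof (rule ccontr)
  assume "\<not> ?thesis"
  hence only: "z = of_real \<xi>" if "poly (map_poly of_int P) z = 0" for z :: complex
    using that by blast
  define R :: "complex poly" where "R = map_poly of_int P"
  have deg: "degree R = degree P" by (simp add: R_def degree_map_poly)
  have "\<exists>z. poly R z = 0"
    using assms(2) deg by (intro fundamental_theorem_of_algebra_alt) (metis degree_pCons_0 less_irrefl)
  hence "{z. poly R z = 0} = {of_real \<xi>}" using only by (auto simp: R_def)
  hence eq: "R = smult (lead_coeff R) ([:- of_real \<xi>, 1:] ^ order (of_real \<xi>) R)"
    using complex_poly_decompose[of R] by simp
  define m where "m = order (of_real \<xi>) R"
  have lead: "lead_coeff R = of_int (lead_coeff P)" by (simp add: deg) (simp add: R_def coeff_map_poly)
  have lead0: "lead_coeff P \<noteq> 0" using assms(2) by auto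
  have "degree R = m" using arg_cong[OF eq, of degree] lead lead0
    by (simp add: degree_power_eq m_def)
  hence m: "m > 0" "degree P = m" using deg assms(2) by simp_all
  have choose: "m choose (m - 1) = m" using m by (cases m) simp_all
  have "coeff R (m - 1) = lead_coeff R * (of_nat m * - of_real \<xi>)"
    using m arg_cong[OF eq[folded m_def], of "\<lambda>f. coeff f (m - 1)"]
    by (simp add: coeff_linear_poly_power choose del: One_nat_def)
  hence "complex_of_real (of_int (coeff P (m - 1))) =
      complex_of_real (of_int (lead_coeff P) * (of_nat m * - \<xi>))"
    unfolding lead by (simp add: R_def coeff_map_poly)
  hence "of_int (coeff P (m - 1)) = of_int (lead_coeff P) * (of_nat m * - \<xi>)"
    by (simp only: of_real_eq_iff)
  hence "\<xi> = - of_int (coeff P (m - 1)) / (of_int (lead_coeff P) * of_nat m)"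
    using lead0 m by (simp add: field_simps)
  also have "\<dots> \<in> \<rat>" by (intro Rats_divide Rats_mult Rats_minus_iff[THEN iffD2]) auto
  finally show False using assms(1) by simp
qed

text \<open>From \<open>H \<le> K k ^ n\<close> and the negative exponent one gets
  \<open>1 / k\<^sup>2 \<le> K powr (2 / n) * H powr (- 2 / n)\<close>, which turns a distance bound
  in \<open>k\<close> into one in the height.\<close>

lemma le_height_powr:
  assumes P: "P \<noteq> 0" "\<And>i. \<bar>real_of_int (coeff P i)\<bar> \<le> K * of_int k ^ n"
    and "K > 0" "k > 0" "n > 0" "C > 0" and d: "d \<le> C / (of_int k)\<^sup>2"
  shows "d \<le> C * K powr (2 / real n) * real_of_int (height_poly P) powr (- 2 / real n)"
proof -
  define H where "H = real_of_int (height_poly P)"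
  have H0: "H > 0" using height_poly_pos[OF P(1)] by (simp add: H_def)
  have "height_poly P \<le> \<lfloor>K * of_int k ^ n\<rfloor>"
    using P(2) by (intro height_poly_le) (simp add: le_floor_iff)
  hence H: "H \<le> K * of_int k ^ n" by (simp add: H_def le_floor_iff)
  have "(of_int k ^ n) powr (- 2 / real n) = (of_int k powr real n) powr (- 2 / real n)"
    using assms by (simp add: powr_realpow)
  also have "\<dots> = of_int k powr (- 2)" using assms by (simp add: powr_powr)
  also have "\<dots> = 1 / (of_int k)\<^sup>2" using assms by (simp add: powr_minus_divide powr_numeral)
  finally have k: "(of_int k ^ n) powr (- 2 / real n) = 1 / (of_int k)\<^sup>2" .
  have "K powr (2 / real n) * (K * of_int k ^ n) powr (- 2 / real n) =
      (K powr (2 / real n) * K powr (- 2 / real n)) * (1 / (of_int k)\<^sup>2)"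
    using assms by (subst powr_mult) (simp_all only: k mult.assoc)
  also have "K powr (2 / real n) * K powr (- 2 / real n) = 1"
    using assms by (simp flip: powr_add)
  finally have "C / (of_int k)\<^sup>2 = C * (K powr (2 / real n) * (K * of_int k ^ n) powr (- 2 / real n))"
    by simp
  also have "\<dots> \<le> C * (K powr (2 / real n) * H powr (- 2 / real n))"
    using H H0 assms by (intro mult_left_mono powr_mono2') auto
  finally show ?thesis using d by (simp add: H_def mult.assoc)
qed

lemma root_const_pos: "root_const n > 0"
  unfolding root_const_def by (intro add_nonneg_pos) auto

theorem theoremA:
  fixes \<xi> :: real and n :: nat
  assumes "\<xi> \<notin> \<rat>" and "n > 0"
  shows "\<exists>c1 c2 :: real. c1 > 0 \<and> c2 > 0 \<and>
    infinite {\<alpha> :: complex. algebraic \<alpha> \<and> alg_degree \<alpha> = n \<and>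
      (\<forall>\<beta>\<in>conjugates \<alpha>. cmod (complex_of_real \<xi> - \<beta>) \<le> c1 * real_of_int (alg_height \<alpha>) powr (- 2 / real n))} \<and>
    infinite {\<alpha> :: complex. algebraic_int \<alpha> \<and> alg_degree \<alpha> = n + 1 \<and>
      (\<forall>\<beta>\<in>conjugates \<alpha> - {\<alpha>}. cmod (complex_of_real \<xi> - \<beta>) \<le> c2 * real_of_int (alg_height \<alpha>) powr (- 2 / real n))}"
proof -
  \<comment> \<open>One constant serves for both parts.\<close>
  define c where "c = root_const n * height_const \<xi> n powr (2 / real n)"
  define S where "S = {\<alpha> :: complex. algebraic \<alpha> \<and> alg_degree \<alpha> = n \<and>
      (\<forall>\<beta>\<in>conjugates \<alpha>. cmod (of_real \<xi> - \<beta>) \<le> c * real_of_int (alg_height \<alpha>) powr (- 2 / real n))}"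
  define T where "T = {\<alpha> :: complex. algebraic_int \<alpha> \<and> alg_degree \<alpha> = n + 1 \<and>
      (\<forall>\<beta>\<in>conjugates \<alpha> - {\<alpha>}. cmod (of_real \<xi> - \<beta>) \<le> c * real_of_int (alg_height \<alpha>) powr (- 2 / real n))}"
  have c: "c > 0" using root_const_pos height_const_pos[of \<xi> n] by (simp add: c_def)
  note height = le_height_powr[OF _ _ height_const_pos[of \<xi> n] _ assms(2) root_const_pos[of n], folded c_def]
  \<comment> \<open>A finite \<open>S\<close> would keep its elements other than \<xi> at a positive
    distance from \<xi>, whereas large \<open>k\<close> produces elements arbitrarily close.\<close>
  have "infinite S"
  proof
    assume "finite S"
    then obtain \<epsilon> where \<epsilon>: "\<epsilon> > 0" "\<And>\<alpha>. \<alpha> \<in> S \<Longrightarrow> \<alpha> \<noteq> of_real \<xi> \<Longrightarrow> \<epsilon> \<le> dist (of_real \<xi>) \<alpha>"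
      using finite_set_avoid by metis
    \<comment> \<open>The bound \<open>k > 1\<close> allows \<open>k\<^sup>2\<close> to be replaced
      by \<open>k\<close> in the final estimate.\<close>
    obtain p q h k where basis: "approx_basis \<xi> p q h k" and "max 1 (root_const n / \<epsilon>) < real_of_int k"
      using approx_basis_exists[OF assms(1)] by metis
    hence k: "1 < real_of_int k" "root_const n / \<epsilon> < of_int k" by auto
    obtain P :: "int poly" where P: "irreducible P" "degree P = n" "lead_coeff P > 0"
      and bound: "\<And>i. \<bar>of_int (coeff P i)\<bar> \<le> height_const \<xi> n * of_int k ^ n"
      and root: "\<And>z. poly (map_poly of_int P) z = 0 \<Longrightarrow>
           cmod (of_real \<xi> - z) \<le> root_const n / (of_int k)\<^sup>2"
      by (rule conjugate_cluster_poly[OF basis assms(2)]) blast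
    have "degree P > 0" using P(2) assms(2) by simp
    then obtain \<alpha> where \<alpha>: "poly (map_poly of_int P) \<alpha> = 0" "\<alpha> \<noteq> complex_of_real \<xi>"
      using exists_root_neq_irrational[OF assms(1)] by blast
    have min: "min_int_poly \<alpha> = P" by (rule min_int_poly_eqI[OF P(1,3) \<alpha>(1)])
    have P0: "P \<noteq> 0" using P by auto
    have "algebraic \<alpha>"
      using \<alpha>(1) P0 by (intro algebraicI[of "map_poly of_int P"]) (auto simp: coeff_map_poly map_poly_eq_0_iff)
    hence "\<alpha> \<in> S" using P(2) height[OF P0 bound _ root] k
      by (simp add: S_def alg_degree_def conjugates_def alg_height_def min)
    hence "\<epsilon> \<le> root_const n / (of_int k)\<^sup>2"
      using \<epsilon>(2) \<alpha>(2) root[OF \<alpha>(1)] by (force simp: dist_norm)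
    also have "\<dots> \<le> root_const n / of_int k"
      using k root_const_pos[of n] by (intro divide_left_mono) (auto simp: power2_eq_square)
    also have "\<dots> < \<epsilon>" using k \<epsilon>(1) by (simp add: field_simps)
    finally show False by simp
  qed
  \<comment> \<open>Now \<alpha> may be the root far from \<xi>, so distances do not separate the
    numbers. The coefficient of \<open>T ^ n\<close> in the minimal polynomial does: it is unbounded
    as \<open>k\<close> grows.\<close>
  moreover have "infinite T"
  proof
    assume "finite T"
    hence "bdd_above ((\<lambda>\<alpha>. real_of_int (coeff (min_int_poly \<alpha>) n)) ` T)" by simp
    then obtain X where X: "\<And>\<alpha>. \<alpha> \<in> T \<Longrightarrow> real_of_int (coeff (min_int_poly \<alpha>) n) \<le> X"
      unfolding bdd_above_def by auto
    obtain p q h k where basis: "approx_basis \<xi> p q h k"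
      and k: "X + real (n + 1) * \<bar>\<xi>\<bar> < real_of_int k"
      by (rule approx_basis_exists[OF assms(1)])
    have k0: "k > 0" using basis by (simp add: approx_basis_def)
    obtain Q :: "int poly" where Q: "irreducible Q" "degree Q = n + 1" "lead_coeff Q = 1"
      and top: "real_of_int (coeff Q n) \<ge> of_int k - real (n + 1) * \<bar>\<xi>\<bar>"
      and bound: "\<And>i. \<bar>of_int (coeff Q i)\<bar> \<le> height_const \<xi> n * of_int k ^ n"
      and root: "\<And>z w. poly (map_poly of_int Q) z = 0 \<Longrightarrow> poly (map_poly of_int Q) w = 0 \<Longrightarrow>
           cmod (of_real \<xi> - z) > root_const n / (of_int k)\<^sup>2 \<Longrightarrow>
           cmod (of_real \<xi> - w) > root_const n / (of_int k)\<^sup>2 \<Longrightarrow> w = z"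
      by (rule almost_conjugate_cluster_poly[OF basis assms(2)]) blast
    define far where "far z \<longleftrightarrow> cmod (of_real \<xi> - z) > root_const n / (of_int k)\<^sup>2" for z
    obtain \<gamma> :: complex where \<gamma>: "poly (map_poly of_int Q) \<gamma> = 0"
      using exists_root_neq_irrational[OF assms(1), of Q] Q(2) by auto
    \<comment> \<open>The exceptional root is taken as \<alpha> if it exists; otherwise any root
      will do.\<close>
    obtain \<alpha> :: complex where \<alpha>: "poly (map_poly of_int Q) \<alpha> = 0"
      and near: "\<And>z. poly (map_poly of_int Q) z = 0 \<Longrightarrow> z \<noteq> \<alpha> \<Longrightarrow> \<not> far z"
    proof (cases "\<exists>z. poly (map_poly of_int Q) z = 0 \<and> far z")
      case True
      thus ?thesis using root that unfolding far_def by metis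
    next
      case False
      thus ?thesis using that \<gamma> by blast
    qed
    have min: "min_int_poly \<alpha> = Q" using Q \<alpha> by (intro min_int_poly_eqI) auto
    have Q0: "Q \<noteq> 0" using Q by auto
    have "algebraic_int \<alpha>" unfolding algebraic_int_altdef_ipoly using \<alpha> Q(3) by blast
    hence "\<alpha> \<in> T" using Q(2) near height[OF Q0 bound k0]
      by (simp add: T_def alg_degree_def conjugates_def alg_height_def min far_def not_less)
    hence "real_of_int (coeff Q n) \<le> X" using X min by metis
    also have "X < of_int k - real (n + 1) * \<bar>\<xi>\<bar>" using k by (simp only: less_diff_eq)
    finally show False using top by simp
  qed
  ultimately show ?thesis using c unfolding S_def T_def by blast
qed

end
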